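(* Let $c$ be a real constant and $\theta=\theta(n)>0$. Suppose $$q=\frac{\theta\log\log n}{\log n}\qquad\text{and}\qquad k=\frac{\log n}{\log\log n}\left(1+\frac{c\,\log\log\log n}{\log\log n}\right).$$ Say that $\theta$ is near if $(\log\log n)^{-\gamma}\ll\theta\ll\log\log\log n$ for all constant $\gamma>0$, and that $\theta$ is far if either $\theta\ll(\log\log n)^{-\gamma}$ for all constant $\gamma$, or else $\log\log\log n\ll\theta$. Then, as $n\to\infty$, $$\mathbb{P}\big[\mathbf{C}_{n,p}\text{ contains a }k\text{-square pattern}\big]\to\begin{cases}0,&\text{if } c\ge1\text{ or }\theta\text{ is far},\\ 1,&\text{if } c<1\text{ and }\theta\text{ is near}.\end{cases}$$
   Context: An $n$-composition is a sequence of $n$ nonnegative integers. For $p=p(n)\in[0,1)$ and $q=1-p$, the geometric random composition $\mathbf{C}_{n,p}$ is the random $n$-composition whose terms are independent, with $\mathbb{P}[\mathbf{C}_{n,p}(i)=j]=qp^j$ for every $j\ge0$ and $i\in\{1,\dots,n\}$. (Thus $\theta$ is understood to be such that $q\in(0,1]$.) For a positive integer $k$, a composition contains a $k$-square pattern if it has $k$ consecutive terms each equal to $k$. When the displayed $k$ is not an integer it is to be read as its integer part $\lfloor k\rfloor$. For positive functions of $n$: $f\ll g$ (or $g\gg f$) means $\lim_{n\to\infty} f/g=0$. *)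

theory Defs
  imports "HOL-Probability.Probability"
begin

text \<open>An \<open>n\<close>-composition is represented by a function \<open>C :: nat \<Rightarrow> nat\<close> whose
  terms are \<open>C 1, \<dots>, C n\<close>; outside \<open>{1..n}\<close> it takes the default value \<open>0\<close>.
  The parameter of the library's \<^const>\<open>geometric_pmf\<close> is the success probability,
  that is, \<open>q = 1 - p\<close>.\<close>

definition geometric_composition :: "nat \<Rightarrow> real \<Rightarrow> (nat \<Rightarrow> nat) pmf" where
  "geometric_composition n p = Pi_pmf {1..n} 0 (\<lambda>_. geometric_pmf (1 - p))"

lemma prob_geometric_composition_term:
  assumes "0 \<le> p" "p < 1" "i \<in> {1..n}"
  shows "measure_pmf.prob (geometric_composition n p) {C. C i = j} = (1 - p) * p ^ j"
proof -
  have "measure_pmf.prob (geometric_composition n p) {C. C i = j} =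
        pmf (map_pmf (\<lambda>C. C i) (geometric_composition n p)) j"
    by (simp add: pmf_map vimage_def)
  also have "\<dots> = pmf (geometric_pmf (1 - p)) j"
    using assms by (simp add: geometric_composition_def Pi_pmf_component)
  also have "\<dots> = (1 - p) * p ^ j"
    using assms by simp
  finally show ?thesis .
qed

lemma indep_vars_geometric_composition:
  "prob_space.indep_vars (measure_pmf (geometric_composition n p))
     (\<lambda>_. count_space UNIV) (\<lambda>i C. C i) {1..n}"
  unfolding geometric_composition_def by (rule indep_vars_Pi_pmf) simp

text \<open>The \<open>k\<close> consecutive terms are those at positions \<open>i + 1, \<dots>, i + k\<close>.\<close>

definition contains_square_pattern :: "nat \<Rightarrow> nat \<Rightarrow> (nat \<Rightarrow> nat) \<Rightarrow> bool" where
  "contains_square_pattern n k C \<longleftrightarrow>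
     0 < k \<and> (\<exists>i. i + k \<le> n \<and> (\<forall>j\<in>{i + 1..i + k}. C j = k))"

definition much_less :: "(nat \<Rightarrow> real) \<Rightarrow> (nat \<Rightarrow> real) \<Rightarrow> bool" (infix "\<lless>" 50) where
  "f \<lless> g \<longleftrightarrow> (\<lambda>n. f n / g n) \<longlonglongrightarrow> 0"

definition near :: "(nat \<Rightarrow> real) \<Rightarrow> bool" where
  "near \<theta> \<longleftrightarrow>
     (\<forall>\<gamma>>0. (\<lambda>n. ln (ln (real n)) powr (- \<gamma>)) \<lless> \<theta>) \<and>
     \<theta> \<lless> (\<lambda>n. ln (ln (ln (real n))))"

definition far :: "(nat \<Rightarrow> real) \<Rightarrow> bool" where
  "far \<theta> \<longleftrightarrow>
     (\<forall>\<gamma>. \<theta> \<lless> (\<lambda>n. ln (ln (real n)) powr (- \<gamma>))) \<or>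
     (\<lambda>n. ln (ln (ln (real n)))) \<lless> \<theta>"

end

theory Submission
  imports Defs "HOL-Real_Asymp.Real_Asymp"
begin

text \<open>A fixed window of \<open>k\<close> consecutive terms is constantly \<open>k\<close> with probability
  \<open>r = (q * p ^ k) ^ k\<close>.  Two elementary estimates control the probability that some window
  has this property.  The union bound over the at most \<open>n\<close> windows gives at most \<open>n * r\<close>.
  Restricting to the \<open>n div k\<close> disjoint windows that tile the composition, whose contents are
  independent, gives at least \<open>1 - (1 - r) ^ (n div k) \<ge> 1 - exp (- r * (n div k))\<close>.
  Passing to disjoint windows loses a factor of about \<open>k\<close>, which is harmless: when
  \<open>\<theta>\<close> is near and \<open>c < 1\<close>, the logarithm of \<open>n * r\<close> grows faster than \<open>ln k\<close>.

  Write \<open>L\<close>, \<open>l\<close>, \<open>m\<close> for the logarithm of \<open>n\<close> iterated once, twice and three times, so that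
  \<open>q = \<theta> * l / L\<close> and \<open>ln q = ln \<theta> + m - l\<close>.  Since \<open>p \<le> exp (- q)\<close>,
  \<open>ln (n * r)\<close> is at most \<open>L + k * (m - l + (ln \<theta> - a * \<theta>))\<close>, where \<open>a = k * l / L\<close> tends to \<open>1\<close>;
  for small \<open>q\<close> the same expression with \<open>2 * a\<close> in place of \<open>a\<close> is a lower bound.
  Inserting \<open>k = L / l * (1 + c * m / l)\<close>, the terms of order \<open>L\<close> cancel and what remains
  is \<open>L / l\<close> times roughly \<open>(1 - c) * m + (ln \<theta> - a * \<theta>)\<close>.  So everything depends on
  comparing the term \<open>ln \<theta> - a * \<theta>\<close> with \<open>m\<close>:
  if \<open>\<theta>\<close> is near, the term is at least \<open>- \<epsilon> * m\<close> for every \<open>\<epsilon> > 0\<close>, and \<open>c < 1\<close> makes the whole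
  tend to infinity; if \<open>\<theta>\<close> is far, it is at most \<open>- \<gamma> * m\<close> for every \<open>\<gamma>\<close>, which beats
  \<open>(1 - c) * m\<close>.  For \<open>c \<ge> 1\<close> and arbitrary \<open>\<theta>\<close> it suffices that \<open>x \<mapsto> ln x - x\<close> is at
  most \<open>- 1\<close>: at the critical value \<open>c = 1\<close>, where the multiple of \<open>m\<close> vanishes, this constant
  alone drives \<open>L / l\<close> times it to minus infinity.\<close>

section \<open>Bounds on the probability of a square pattern\<close>

lemma prob_window_constant:
  assumes p: "0 \<le> p" "p < 1" and A: "A \<subseteq> {1..n}"
  shows "measure_pmf.prob (geometric_composition n p) {C. \<forall>j\<in>A. C j = k} =
           ((1 - p) * p ^ k) ^ card A"
proof -
  let ?B = "\<lambda>j. if j \<in> A then {k} else UNIV"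
  have "{C. \<forall>j\<in>A. C j = k} = Pi {1..n} ?B"
    using A by (auto simp: Pi_def split: if_splits)
  then have "measure_pmf.prob (geometric_composition n p) {C. \<forall>j\<in>A. C j = k} =
      (\<Prod>j\<in>{1..n}. measure_pmf.prob (geometric_pmf (1 - p)) (?B j))"
    by (simp add: geometric_composition_def measure_Pi_pmf_Pi)
  also have "\<dots> = (\<Prod>j\<in>{1..n}. if j \<in> A then (1 - p) * p ^ k else 1)"
    using p by (intro prod.cong) (auto simp: measure_pmf_single)
  also have "\<dots> = (\<Prod>j\<in>A. (1 - p) * p ^ k)"
    using A by (simp add: prod.inter_restrict [symmetric] Int_absorb1)
  finally show ?thesis by simp
qed

lemma prob_square_pattern_le:
  assumes p: "0 \<le> p" "p < 1"
  shows "measure_pmf.prob (geometric_composition n p) {C. contains_square_pattern n k C} \<le>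
           real n * ((1 - p) * p ^ k) ^ k"
proof (cases "0 < k \<and> k \<le> n")
  case False
  then have "{C. contains_square_pattern n k C} = {}"
    by (auto simp: contains_square_pattern_def)
  then show ?thesis using p by simp
next
  case True
  let ?M = "measure_pmf (geometric_composition n p)"
  let ?E = "\<lambda>i. {C. \<forall>j\<in>{i + 1..i + k}. C j = k}"
  have "measure ?M {C. contains_square_pattern n k C} \<le> measure ?M (\<Union>i\<in>{..n - k}. ?E i)"
    by (intro measure_pmf.finite_measure_mono)
      (auto simp: contains_square_pattern_def le_diff_conv2)
  also have "\<dots> \<le> (\<Sum>i\<in>{..n - k}. measure ?M (?E i))"
    by (intro measure_pmf.finite_measure_subadditive_finite) auto
  also have "\<dots> = (\<Sum>i\<in>{..n - k}. ((1 - p) * p ^ k) ^ k)"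
  proof (intro sum.cong refl)
    fix i assume "i \<in> {..n - k}"
    with True have "{i + 1..i + k} \<subseteq> {1..n}" by auto
    from prob_window_constant [OF p this, of k]
    show "measure ?M (?E i) = ((1 - p) * p ^ k) ^ k" by simp
  qed
  also have "\<dots> = real (Suc (n - k)) * ((1 - p) * p ^ k) ^ k" by simp
  also have "\<dots> \<le> real n * ((1 - p) * p ^ k) ^ k"
    using True p by (intro mult_right_mono) auto
  finally show ?thesis .
qed

text \<open>Avoiding all patterns implies avoiding those in the windows \<open>{i * k + 1..i * k + k}\<close>
  with \<open>i < n div k\<close>.  These windows are disjoint, so the corresponding events are independent.\<close>

lemma prob_square_pattern_ge:
  assumes p: "0 \<le> p" "p < 1" and k: "0 < k" "k \<le> n"
  shows "1 - exp (- (real (n div k) * ((1 - p) * p ^ k) ^ k)) \<le>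
           measure_pmf.prob (geometric_composition n p) {C. contains_square_pattern n k C}"
proof -
  let ?M = "measure_pmf (geometric_composition n p)"
  let ?r = "((1 - p) * p ^ k) ^ k"
  let ?W = "\<lambda>i. {i * k + 1..i * k + k}"
  let ?N = "{..<n div k}"
  let ?X = "\<lambda>i C. restrict C (?W i)"
  let ?S = "\<lambda>i. Pi\<^sub>M (?W i) (\<lambda>_. count_space (UNIV :: nat set))"
  let ?A = "\<lambda>i. space (?S i) - (\<Pi>\<^sub>E j\<in>?W i. {k})"
  have end_le: "i * k + k \<le> n" if "i < n div k" for i
  proof -
    have "(i + 1) * k \<le> (n div k) * k" using that by (intro mult_right_mono) auto
    also have "\<dots> \<le> n" by simp
    finally show ?thesis by (simp add: algebra_simps)
  qed
  have sub: "?W i \<subseteq> {1..n}" if "i < n div k" for i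
    using end_le [OF that] by auto
  have disj: "disjoint_family_on ?W ?N"
  proof -
    have "?W i \<inter> ?W j = {}" if "i < j" for i j
    proof -
      have "(i + 1) * k \<le> j * k" using that by (intro mult_right_mono) auto
      then show ?thesis by (auto simp: algebra_simps)
    qed
    then show ?thesis
      unfolding disjoint_family_on_def by (metis inf_commute nat_neq_iff)
  qed
  have avoid: "?X i -` ?A i \<inter> space ?M = - {C. \<forall>j\<in>?W i. C j = k}" for i
  proof -
    have "restrict C (?W i) \<in> (\<Pi>\<^sub>E j\<in>?W i. {k}) \<longleftrightarrow> (\<forall>j\<in>?W i. C j = k)" for C
      unfolding PiE_iff by auto
    then show ?thesis by (auto simp: space_PiM)
  qed
  have indep: "prob_space.indep_vars ?M ?S ?X ?N"
    by (rule prob_space.indep_vars_restrict [OF prob_space_measure_pmf indep_vars_geometric_composition _ disj])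
      (use sub in auto)
  have "0 < n div k" using k by (simp add: div_greater_zero_iff)
  moreover have "?A i \<in> sets (?S i)" for i
    by (intro sets.Diff sets.top sets_PiM_I_finite) auto
  ultimately have "measure ?M (\<Inter>i\<in>?N. ?X i -` ?A i \<inter> space ?M) =
      (\<Prod>i\<in>?N. measure ?M (?X i -` ?A i \<inter> space ?M))"
    by (intro prob_space.indep_varsD_finite [OF prob_space_measure_pmf indep]) auto
  also have "\<dots> = (\<Prod>i\<in>?N. 1 - ?r)"
  proof (intro prod.cong refl)
    fix i assume "i \<in> ?N"
    then have "measure ?M {C. \<forall>j\<in>?W i. C j = k} = ?r"
      using prob_window_constant [OF p sub, of i k] by simp
    then show "measure ?M (?X i -` ?A i \<inter> space ?M) = 1 - ?r"
      unfolding avoid using measure_pmf.prob_compl [of "{C. \<forall>j\<in>?W i. C j = k}"]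
      by (simp add: Compl_eq_Diff_UNIV)
  qed
  also have "\<dots> = (1 - ?r) ^ (n div k)" by simp
  also have "\<dots> \<le> exp (- ?r) ^ (n div k)"
  proof (rule power_mono)
    have "(1 - p) * p ^ k \<le> 1 * 1" using p by (intro mult_mono power_le_one) auto
    then show "0 \<le> 1 - ?r" using p by (simp add: power_le_one)
    show "1 - ?r \<le> exp (- ?r)" using exp_ge_add_one_self [of "- ?r"] by simp
  qed
  also have "\<dots> = exp (- (real (n div k) * ?r))"
    by (simp add: exp_of_nat_mult [symmetric])
  finally have *: "measure ?M (\<Inter>i\<in>?N. ?X i -` ?A i \<inter> space ?M) \<le> \<dots>" .
  have "- {C. contains_square_pattern n k C} \<subseteq> (\<Inter>i\<in>?N. ?X i -` ?A i \<inter> space ?M)"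
    unfolding avoid using k end_le by (auto simp: contains_square_pattern_def)
  then have "measure ?M (- {C. contains_square_pattern n k C}) \<le>
      measure ?M (\<Inter>i\<in>?N. ?X i -` ?A i \<inter> space ?M)"
    by (intro measure_pmf.finite_measure_mono) auto
  with * show ?thesis
    using measure_pmf.prob_compl [of "{C. contains_square_pattern n k C}"]
    by (simp add: Compl_eq_Diff_UNIV)
qed

section \<open>The probability of a window on the logarithmic scale\<close>

text \<open>With \<open>x = k * l / L\<close> in the exponents below, \<open>k * q = x * \<theta>\<close>.  The two bounds come from
  \<open>exp (- 2 * q) \<le> 1 - q \<le> exp (- q)\<close>, the first of which requires \<open>q \<le> 1 / 2\<close>.\<close>

lemma window_prob_le_exp:
  fixes L l \<theta> q :: real
  assumes "0 < L" "0 < l" "0 < \<theta>" "q = \<theta> * l / L" "q \<le> 1"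
  shows "(q * (1 - q) ^ k) ^ k \<le>
           exp (real k * (ln l - ln L + (ln \<theta> - real k * l / L * \<theta>)))"
proof -
  have q: "0 < q" using assms by simp
  have "(1 - q) ^ k \<le> exp (- q) ^ k"
    using assms exp_ge_add_one_self [of "- q"] by (intro power_mono) auto
  then have "q * (1 - q) ^ k \<le> exp (ln q) * exp (- q) ^ k"
    using q by simp
  also have "\<dots> = exp (ln q - real k * q)"
    by (simp add: exp_of_nat_mult [symmetric] exp_add [symmetric])
  finally have "(q * (1 - q) ^ k) ^ k \<le> exp (ln q - real k * q) ^ k"
    using assms q by (intro power_mono) auto
  also have "\<dots> = exp (real k * (ln q - real k * q))"
    by (simp add: exp_of_nat_mult)
  also have "ln q - real k * q = ln l - ln L + (ln \<theta> - real k * l / L * \<theta>)"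
    using assms by (simp add: ln_mult ln_div)
  finally show ?thesis .
qed

lemma window_prob_ge_exp:
  fixes L l \<theta> q :: real
  assumes "0 < L" "0 < l" "0 < \<theta>" "q = \<theta> * l / L" "q \<le> 1 / 2"
  shows "exp (real k * (ln l - ln L + (ln \<theta> - 2 * (real k * l / L) * \<theta>))) \<le>
           (q * (1 - q) ^ k) ^ k"
proof -
  have q: "0 < q" using assms by simp
  have "exp (- 2 * q) \<le> 1 - q"
  proof -
    have "1 / (1 - q) = 1 + q / (1 - q)" using assms by (simp add: field_simps)
    also have "\<dots> \<le> 1 + 2 * q" using assms q by (simp add: field_simps)
    also have "\<dots> \<le> exp (2 * q)" by (rule exp_ge_add_one_self)
    finally have "1 / (1 - q) \<le> exp (2 * q)" .
    then have "1 \<le> exp (2 * q) * (1 - q)" using assms by (simp add: pos_divide_le_eq)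
    then have "exp (- (2 * q)) * 1 \<le> exp (- (2 * q)) * (exp (2 * q) * (1 - q))"
      by (intro mult_left_mono) auto
    also have "\<dots> = 1 - q" by (simp add: mult.assoc [symmetric] exp_add [symmetric])
    finally show ?thesis by simp
  qed
  then have "exp (- 2 * q) ^ k \<le> (1 - q) ^ k" by (intro power_mono) auto
  then have "exp (ln q) * exp (- 2 * q) ^ k \<le> q * (1 - q) ^ k"
    using q by simp
  moreover have "exp (ln q) * exp (- 2 * q) ^ k = exp (ln q - 2 * (real k * q))"
    by (simp add: exp_of_nat_mult [symmetric] exp_add [symmetric] algebra_simps)
  ultimately have "exp (ln q - 2 * (real k * q)) ^ k \<le> (q * (1 - q) ^ k) ^ k"
    by (intro power_mono) auto
  moreover have "exp (ln q - 2 * (real k * q)) ^ k = exp (real k * (ln q - 2 * (real k * q)))"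
    by (simp add: exp_of_nat_mult)
  moreover have "ln q - 2 * (real k * q) = ln l - ln L + (ln \<theta> - 2 * (real k * l / L) * \<theta>)"
    using assms by (simp add: ln_mult ln_div)
  ultimately show ?thesis by simp
qed

section \<open>Growth of the exponents\<close>

text \<open>The limits in this section are taken along the function \<open>k\<close> of the theorem, as a
  function of \<open>n\<close>, before rounding.\<close>

definition critical_length :: "real \<Rightarrow> nat \<Rightarrow> real" where
  "critical_length c n = ln (real n) / ln (ln (real n)) *
     (1 + c * ln (ln (ln (real n))) / ln (ln (real n)))"

lemma critical_length_at_top: "filterlim (critical_length c) at_top sequentially"
  unfolding critical_length_def by real_asymp

lemma eventually_le_critical_length_ratio:
  "\<forall>\<^sub>F n in sequentially. 3 / 4 \<le> (critical_length c n - 1) * ln (ln (real n)) / ln (real n)"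
proof -
  have "(\<lambda>n. (critical_length c n - 1) * ln (ln (real n)) / ln (real n)) \<longlonglongrightarrow> 1"
    unfolding critical_length_def by real_asymp
  from order_tendstoD(1) [OF this, of "3 / 4"] show ?thesis
    by (auto elim: eventually_mono)
qed

lemma eventually_critical_length_ratio_le:
  "\<forall>\<^sub>F n in sequentially. critical_length c n * ln (ln (real n)) / ln (real n) \<le> 2"
proof -
  have "(\<lambda>n. critical_length c n * ln (ln (real n)) / ln (real n)) \<longlonglongrightarrow> 1"
    unfolding critical_length_def by real_asymp
  from order_tendstoD(2) [OF this, of 2] show ?thesis
    by (auto elim: eventually_mono)
qed

text \<open>The next three limits are the three regimes of the theorem.  With
  \<open>L\<close>, \<open>l\<close>, \<open>m\<close> as above, a factor \<open>\<eta> * m - l\<close> leaves \<open>(\<eta> - c) * m * L / l\<close> after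
  cancellation of the terms of order \<open>L\<close>; for \<open>\<eta> = c = 1\<close> this vanishes and the extra \<open>- 1 / 2\<close>
  leaves \<open>- (L / l) / 2\<close>.  Either dominates the corrections for the rounding of \<open>k\<close>
  (the \<open>- 1\<close>) and for the use of disjoint windows only (the term \<open>ln (2 * k)\<close>).\<close>

lemma exponent_at_bot:
  assumes "\<eta> < c"
  shows "filterlim (\<lambda>n. ln (real n) + (critical_length c n - 1) *
           (\<eta> * ln (ln (ln (real n))) - ln (ln (real n)))) at_bot sequentially"
  unfolding critical_length_def using assms by real_asymp

lemma exponent_at_bot_boundary:
  "filterlim (\<lambda>n. ln (real n) + (critical_length 1 n - 1) *
     (ln (ln (ln (real n))) - 1 / 2 - ln (ln (real n)))) at_bot sequentially"
  unfolding critical_length_def by real_asymp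

lemma exponent_at_top:
  assumes "c < \<eta>"
  shows "filterlim (\<lambda>n. ln (real n) + critical_length c n *
           (\<eta> * ln (ln (ln (real n))) - ln (ln (real n))) - ln (2 * critical_length c n))
           at_top sequentially"
  unfolding critical_length_def using assms by real_asymp

section \<open>The size of the term depending on \<open>\<theta>\<close>\<close>

lemma ln_minus_mult_le:
  fixes a \<theta> :: real
  assumes "0 < \<theta>" "3 / 4 \<le> a"
  shows "ln \<theta> - a * \<theta> \<le> - (1 / 2)"
proof -
  have "ln \<theta> + ln a \<le> a * \<theta> - 1"
    using ln_le_minus_one [of "a * \<theta>"] assms by (simp add: ln_mult)
  moreover have "- ln a \<le> 1 / a - 1"
    using ln_le_minus_one [of "1 / a"] assms by (simp add: ln_div)
  moreover have "1 / a \<le> 4 / 3" using assms by (simp add: field_simps)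
  ultimately show ?thesis by linarith
qed

lemma ln_ln_ln_at_top: "filterlim (\<lambda>n. ln (ln (ln (real n)))) at_top sequentially"
  by real_asymp

lemma eventually_less_of_much_less:
  assumes "f \<lless> g" "\<forall>\<^sub>F n in sequentially. 0 < g n" "0 < \<epsilon>"
  shows "\<forall>\<^sub>F n in sequentially. f n < \<epsilon> * g n"
proof -
  have "\<forall>\<^sub>F n in sequentially. f n / g n < \<epsilon>"
    using assms order_tendstoD(2) unfolding much_less_def by blast
  with assms(2) show ?thesis
    by eventually_elim (simp add: pos_divide_less_eq)
qed

text \<open>For small \<open>\<theta>\<close> it is \<open>ln \<theta>\<close>, for large \<open>\<theta>\<close> it is the linear term, that is very negative
  compared with \<open>ln (ln (ln n))\<close>.\<close>

lemma far_imp_eventually_le: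
  assumes "far \<theta>" "\<And>n. 0 < \<theta> n"
  shows "\<forall>\<^sub>F n in sequentially. \<forall>a\<ge>3 / 4.
           ln (\<theta> n) - a * \<theta> n \<le> - (\<gamma> * ln (ln (ln (real n))))"
proof -
  have l: "\<forall>\<^sub>F n in sequentially. 0 < ln (ln (real n))" by real_asymp
  have m: "\<forall>\<^sub>F n in sequentially. 0 < ln (ln (ln (real n)))" by real_asymp
  from assms(1) consider (small) "\<theta> \<lless> (\<lambda>n. ln (ln (real n)) powr (- \<gamma>))"
    | (large) "(\<lambda>n. ln (ln (ln (real n)))) \<lless> \<theta>"
    unfolding far_def by blast
  then show ?thesis
  proof cases
    case small
    then have "\<forall>\<^sub>F n in sequentially. \<theta> n < 1 * ln (ln (real n)) powr (- \<gamma>)"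
      by (rule eventually_less_of_much_less) (use l in \<open>auto elim: eventually_mono\<close>)
    with l show ?thesis
    proof eventually_elim
      case (elim n)
      then have "ln (\<theta> n) \<le> ln (ln (ln (real n)) powr (- \<gamma>))"
        using assms(2) [of n] by (subst ln_le_cancel_iff) auto
      also have "\<dots> = - (\<gamma> * ln (ln (ln (real n))))"
        using elim by (simp add: ln_powr)
      finally have *: "ln (\<theta> n) \<le> - (\<gamma> * ln (ln (ln (real n))))" .
      show ?case
      proof (intro allI impI)
        fix a :: real assume "3 / 4 \<le> a"
        then have "0 \<le> a * \<theta> n" using assms(2) [of n] by simp
        with * show "ln (\<theta> n) - a * \<theta> n \<le> - (\<gamma> * ln (ln (ln (real n))))" by linarith
      qed
    qed
  next
    case large
    define \<epsilon> where "\<epsilon> = 1 / (4 * (\<bar>\<gamma>\<bar> + 1))"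
    have \<epsilon>: "0 < \<epsilon>" by (simp add: \<epsilon>_def add_nonneg_pos)
    have "\<forall>\<^sub>F n in sequentially. ln (ln (ln (real n))) < \<epsilon> * \<theta> n"
      using large by (rule eventually_less_of_much_less) (use \<epsilon> assms(2) in auto)
    with m show ?thesis
    proof eventually_elim
      case (elim n)
      have "4 * (\<bar>\<gamma>\<bar> + 1) * ln (ln (ln (real n))) < \<theta> n"
        using elim by (simp add: \<epsilon>_def field_simps)
      moreover have "\<gamma> * ln (ln (ln (real n))) \<le> (\<bar>\<gamma>\<bar> + 1) * ln (ln (ln (real n)))"
        using elim by (intro mult_right_mono) auto
      ultimately have *: "\<gamma> * ln (ln (ln (real n))) \<le> \<theta> n / 4" by linarith
      have "ln (\<theta> n) - 1 / 2 * \<theta> n \<le> 0"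
        \<comment> \<open>\<open>ln (\<theta> / 2) \<le> \<theta> / 2 - 1\<close> and \<open>ln 2 \<le> 1\<close>\<close>
        using ln_le_minus_one [of "\<theta> n / 2"] ln_le_minus_one [of "2::real"] assms(2) [of n]
        by (simp add: ln_div)
      with * have **: "ln (\<theta> n) - 3 / 4 * \<theta> n \<le> - (\<gamma> * ln (ln (ln (real n))))"
        by linarith
      show ?case
      proof (intro allI impI)
        fix a :: real assume "3 / 4 \<le> a"
        then have "3 / 4 * \<theta> n \<le> a * \<theta> n" using assms(2) [of n] by (intro mult_right_mono) auto
        with ** show "ln (\<theta> n) - a * \<theta> n \<le> - (\<gamma> * ln (ln (ln (real n))))" by linarith
      qed
    qed
  qed
qed

lemma near_imp_eventually_ge:
  assumes "near \<theta>" "\<And>n. 0 < \<theta> n" "0 < \<epsilon>"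
  shows "\<forall>\<^sub>F n in sequentially. \<forall>a\<le>2.
           - (\<epsilon> * ln (ln (ln (real n)))) \<le> ln (\<theta> n) - 2 * a * \<theta> n"
proof -
  have l: "\<forall>\<^sub>F n in sequentially. 0 < ln (ln (real n))" by real_asymp
  have m: "\<forall>\<^sub>F n in sequentially. 0 < ln (ln (ln (real n)))" by real_asymp
  have "(\<lambda>n. ln (ln (real n)) powr (- (\<epsilon> / 2))) \<lless> \<theta>"
    using assms(1,3) unfolding near_def by (meson half_gt_zero)
  then have lower: "\<forall>\<^sub>F n in sequentially. ln (ln (real n)) powr (- (\<epsilon> / 2)) < 1 * \<theta> n"
    by (rule eventually_less_of_much_less) (use assms(2) in auto)
  have "\<theta> \<lless> (\<lambda>n. ln (ln (ln (real n))))"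
    using assms(1) unfolding near_def by blast
  then have "\<forall>\<^sub>F n in sequentially. \<theta> n < \<epsilon> / 8 * ln (ln (ln (real n)))"
    by (rule eventually_less_of_much_less) (use m assms(3) in auto)
  with l lower show ?thesis
  proof eventually_elim
    case (elim n)
    have "- (\<epsilon> / 2 * ln (ln (ln (real n)))) = ln (ln (ln (real n)) powr (- (\<epsilon> / 2)))"
      using elim by (simp add: ln_powr)
    also have "\<dots> \<le> ln (\<theta> n)"
      using elim by (subst ln_le_cancel_iff) (use assms(2) in auto)
    finally have *: "- (\<epsilon> / 2 * ln (ln (ln (real n)))) \<le> ln (\<theta> n)" .
    show ?case
    proof (intro allI impI)
      fix a :: real assume "a \<le> 2"
      then have "2 * a * \<theta> n \<le> 4 * \<theta> n" using assms(2) [of n] by (intro mult_right_mono) auto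
      with * elim show "- (\<epsilon> * ln (ln (ln (real n)))) \<le> ln (\<theta> n) - 2 * a * \<theta> n"
        by linarith
    qed
  qed
qed

section \<open>The two limits\<close>

lemma eventually_iterated_ln_pos:
  "\<forall>\<^sub>F n in sequentially. 0 < n \<and> 0 < ln (real n) \<and> 0 < ln (ln (real n)) \<and>
     0 < ln (ln (ln (real n)))"
  by (intro eventually_conj) real_asymp+

text \<open>As \<open>s - l \<le> 0\<close>, where \<open>l = ln (ln n)\<close>, replacing \<open>\<lfloor>k\<rfloor>\<close>
  by the smaller \<open>k - 1\<close> in the exponent only
  increases it.  For the same reason the exponent may be formed with any \<open>d \<le> c\<close>, which allows
  the case \<open>c > 1\<close> to be reduced to the boundary.\<close>

lemma prob_square_pattern_tendsto_0:
  fixes c d :: real and \<theta> p k s :: "nat \<Rightarrow> real"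
  assumes \<theta>: "\<And>n. 0 < \<theta> n" and p: "\<And>n. p n \<in> {0..<1}"
    and q: "\<forall>\<^sub>F n in sequentially. 1 - p n = \<theta> n * ln (ln (real n)) / ln (real n)"
    and k: "\<forall>\<^sub>F n in sequentially. k n = critical_length c n"
    and dc: "d \<le> c"
    and s: "\<forall>\<^sub>F n in sequentially. \<forall>a\<ge>3 / 4.
              ln (ln (ln (real n))) + (ln (\<theta> n) - a * \<theta> n) \<le> s n"
    and s_le: "\<forall>\<^sub>F n in sequentially. s n \<le> ln (ln (real n))"
    and lim: "filterlim (\<lambda>n. ln (real n) + (critical_length d n - 1) * (s n - ln (ln (real n))))
                at_bot sequentially"
  shows "(\<lambda>n. measure_pmf.prob (geometric_composition n (p n))
            {C. contains_square_pattern n (nat \<lfloor>k n\<rfloor>) C}) \<longlonglongrightarrow> 0"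
proof (rule tendsto_sandwich [OF _ _ tendsto_const])
  show "(\<lambda>n. exp (ln (real n) + (critical_length d n - 1) * (s n - ln (ln (real n))))) \<longlonglongrightarrow> 0"
    using filterlim_compose [OF exp_at_bot lim] .
  have ratio: "\<forall>\<^sub>F n in sequentially.
      3 / 4 \<le> (critical_length c n - 1) * ln (ln (real n)) / ln (real n)"
    by (rule eventually_le_critical_length_ratio)
  have "\<forall>\<^sub>F n in sequentially. 1 \<le> critical_length c n"
    using critical_length_at_top by (simp add: filterlim_at_top)
  with ratio q k s s_le eventually_iterated_ln_pos
  show "\<forall>\<^sub>F n in sequentially. measure_pmf.prob (geometric_composition n (p n))
            {C. contains_square_pattern n (nat \<lfloor>k n\<rfloor>) C} \<le>
          exp (ln (real n) + (critical_length d n - 1) * (s n - ln (ln (real n))))"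
  proof eventually_elim
    case (elim n)
    define L l m where "L = ln (real n)" and "l = ln (ln (real n))" and "m = ln (ln (ln (real n)))"
    define K where "K = nat \<lfloor>k n\<rfloor>"
    have pos: "0 < n" "0 < L" "0 < l" "0 < m" using elim by (auto simp: L_def l_def m_def)
    have K: "critical_length c n - 1 \<le> real K" using elim unfolding K_def by linarith
    have "3 / 4 \<le> (critical_length c n - 1) * l / L" using elim by (simp add: L_def l_def)
    also have "\<dots> \<le> real K * l / L"
      using K pos by (intro divide_right_mono mult_right_mono) auto
    finally have "3 / 4 \<le> real K * l / L" .
    then have sn: "m + (ln (\<theta> n) - real K * l / L * \<theta> n) \<le> s n"
      using elim unfolding m_def by blast
    have "critical_length d n \<le> critical_length c n"
      unfolding critical_length_def using pos dc
      by (intro mult_left_mono add_left_mono divide_right_mono mult_right_mono)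
        (auto simp: L_def l_def m_def)
    then have dK: "critical_length d n - 1 \<le> real K" using K by linarith
    have "measure_pmf.prob (geometric_composition n (p n)) {C. contains_square_pattern n K C} \<le>
        real n * ((1 - p n) * (1 - (1 - p n)) ^ K) ^ K"
      using prob_square_pattern_le [of "p n" n K] p [of n] by simp
    also have "\<dots> \<le> exp L * exp (real K * (ln l - ln L + (ln (\<theta> n) - real K * l / L * \<theta> n)))"
    proof (rule mult_mono)
      have "1 - p n = \<theta> n * l / L" using elim by (simp add: L_def l_def)
      moreover have "1 - p n \<le> 1" using p [of n] by simp
      ultimately show "((1 - p n) * (1 - (1 - p n)) ^ K) ^ K \<le>
          exp (real K * (ln l - ln L + (ln (\<theta> n) - real K * l / L * \<theta> n)))"
        using pos \<theta> [of n] by (intro window_prob_le_exp)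
      show "0 \<le> ((1 - p n) * (1 - (1 - p n)) ^ K) ^ K" using p [of n] by simp
    qed (use pos in \<open>simp_all add: L_def\<close>)
    also have "\<dots> = exp (L + real K * (m + (ln (\<theta> n) - real K * l / L * \<theta> n) - l))"
      unfolding exp_add [symmetric] by (simp add: L_def l_def m_def algebra_simps)
    also have "\<dots> \<le> exp (L + real K * (s n - l))"
      using sn by (simp add: mult_left_mono)
    also have "\<dots> \<le> exp (L + (critical_length d n - 1) * (s n - l))"
      using dK elim by (simp add: l_def mult_right_mono_neg)
    finally show ?case by (simp add: L_def l_def K_def)
  qed
qed simp

lemma prob_square_pattern_tendsto_1:
  fixes c :: real and \<theta> p k :: "nat \<Rightarrow> real"
  assumes \<theta>: "\<And>n. 0 < \<theta> n" and p: "\<And>n. p n \<in> {0..<1}"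
    and q: "\<forall>\<^sub>F n in sequentially. 1 - p n = \<theta> n * ln (ln (real n)) / ln (real n)"
    and k: "\<forall>\<^sub>F n in sequentially. k n = critical_length c n"
    and "c < 1" "near \<theta>"
  shows "(\<lambda>n. measure_pmf.prob (geometric_composition n (p n))
            {C. contains_square_pattern n (nat \<lfloor>k n\<rfloor>) C}) \<longlonglongrightarrow> 1"
proof -
  \<comment> \<open>half of the available gap \<open>1 - c\<close> is spent on the term depending on \<open>\<theta>\<close>\<close>
  define \<epsilon> where "\<epsilon> = (1 - c) / 2"
  have \<epsilon>: "0 < \<epsilon>" "c < 1 - \<epsilon>" using \<open>c < 1\<close> by (simp_all add: \<epsilon>_def field_simps)
  define g where "g n = ln (real n) + critical_length c n *
      ((1 - \<epsilon>) * ln (ln (ln (real n))) - ln (ln (real n))) - ln (2 * critical_length c n)" for n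
  have "filterlim g at_top sequentially"
    unfolding g_def by (rule exponent_at_top) (use \<epsilon> in simp)
  then have "filterlim (\<lambda>n. exp (g n)) at_top sequentially"
    by (rule filterlim_compose [OF exp_at_top])
  then have "((\<lambda>n. exp (- exp (g n))) \<longlongrightarrow> 0) sequentially"
    by (intro filterlim_compose [OF exp_at_bot])
      (simp add: filterlim_uminus_at_bot)
  then have lower: "(\<lambda>n. 1 - exp (- exp (g n))) \<longlonglongrightarrow> 1"
    using tendsto_diff [OF tendsto_const [of "1::real"]] by fastforce
  have theta_less: "\<forall>\<^sub>F n in sequentially. \<theta> n < 1 * ln (ln (ln (real n)))"
    using \<open>near \<theta>\<close> eventually_iterated_ln_pos
    by (intro eventually_less_of_much_less) (auto simp: near_def elim: eventually_mono)
  have "\<forall>\<^sub>F n in sequentially. ln (ln (ln (real n))) * ln (ln (real n)) / ln (real n) \<le> 1 / 2"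
    by real_asymp
  moreover have "\<forall>\<^sub>F n in sequentially. 1 \<le> critical_length c n"
    using critical_length_at_top by (simp add: filterlim_at_top)
  moreover have "\<forall>\<^sub>F n in sequentially. critical_length c n \<le> real n"
    unfolding critical_length_def by real_asymp
  moreover have "\<forall>\<^sub>F n in sequentially. (1 - \<epsilon>) * ln (ln (ln (real n))) \<le> ln (ln (real n))"
    by real_asymp
  ultimately have "\<forall>\<^sub>F n in sequentially. 1 - exp (- exp (g n)) \<le>
      measure_pmf.prob (geometric_composition n (p n))
        {C. contains_square_pattern n (nat \<lfloor>k n\<rfloor>) C}"
    using q k eventually_critical_length_ratio_le [of c] eventually_iterated_ln_pos theta_less
      near_imp_eventually_ge [OF \<open>near \<theta>\<close> \<theta> \<epsilon>(1)]
  proof eventually_elim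
    case (elim n)
    define L l m where "L = ln (real n)" and "l = ln (ln (real n))" and "m = ln (ln (ln (real n)))"
    define K where "K = nat \<lfloor>k n\<rfloor>"
    define r where "r = ((1 - p n) * p n ^ K) ^ K"
    have pos: "0 < n" "0 < L" "0 < l" "0 < m" using elim by (auto simp: L_def l_def m_def)
    have K: "real K \<le> critical_length c n" "0 < K" "K \<le> n" using elim unfolding K_def by linarith+
    have "\<theta> n * l / L \<le> m * l / L"
      using elim pos by (intro divide_right_mono mult_right_mono) (auto simp: m_def)
    also have "\<dots> \<le> 1 / 2" using elim by (simp only: L_def l_def m_def)
    finally have q_le: "1 - p n \<le> 1 / 2" using elim by (simp only: L_def l_def)
    have \<theta>_lower: "\<forall>a\<le>2. - (\<epsilon> * m) \<le> ln (\<theta> n) - 2 * a * \<theta> n"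
      using elim by (simp only: m_def)
    have "real K * l / L \<le> critical_length c n * l / L"
      using K pos by (intro divide_right_mono mult_right_mono) auto
    also have "\<dots> \<le> 2" using elim by (simp only: L_def l_def)
    finally have "real K * l / L \<le> 2" .
    then have \<theta>_term: "- (\<epsilon> * m) \<le> ln (\<theta> n) - 2 * (real K * l / L) * \<theta> n"
      using \<theta>_lower by blast
    have "exp (critical_length c n * ((1 - \<epsilon>) * m - l)) \<le> exp (real K * ((1 - \<epsilon>) * m - l))"
      using K elim by (simp add: l_def m_def mult_right_mono_neg)
    also have "\<dots> \<le> exp (real K * (ln l - ln L + (ln (\<theta> n) - 2 * (real K * l / L) * \<theta> n)))"
    proof -
      have "(1 - \<epsilon>) * m - l \<le> ln l - ln L + (ln (\<theta> n) - 2 * (real K * l / L) * \<theta> n)"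
        using \<theta>_term by (simp add: L_def l_def m_def algebra_simps)
      then show ?thesis by (simp add: mult_left_mono)
    qed
    also have "\<dots> \<le> ((1 - p n) * (1 - (1 - p n)) ^ K) ^ K"
      using elim pos \<theta> [of n] q_le
      by (intro window_prob_ge_exp) (auto simp: L_def l_def)
    finally have r: "exp (critical_length c n * ((1 - \<epsilon>) * m - l)) \<le> r" by (simp add: r_def)
    have windows: "real n / (2 * critical_length c n) \<le> real (n div K)"
    proof -
      have "n < K * (n div K) + K"
        using dividend_less_times_div [of K n] K(2) by (simp only: add.commute)
      also have "\<dots> \<le> K * (n div K) + K * (n div K)"
        using K by (simp add: div_greater_zero_iff Suc_le_eq)
      finally have "n \<le> (n div K) * (2 * K)" by (simp add: algebra_simps)
      then have "real n \<le> real ((n div K) * (2 * K))" by (simp only: of_nat_le_iff)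
      then have "real n \<le> real (n div K) * (2 * real K)" by simp
      also have "\<dots> \<le> real (n div K) * (2 * critical_length c n)"
        using K by (intro mult_left_mono) auto
      finally show ?thesis using elim by (simp add: pos_divide_le_eq)
    qed
    have "exp (g n) = real n / (2 * critical_length c n) *
        exp (critical_length c n * ((1 - \<epsilon>) * m - l))"
      using elim pos by (simp add: g_def exp_add exp_diff l_def m_def)
    also have "\<dots> \<le> real (n div K) * r"
      using windows r elim by (intro mult_mono) auto
    finally have "1 - exp (- exp (g n)) \<le> 1 - exp (- (real (n div K) * r))" by simp
    also have "\<dots> \<le> measure_pmf.prob (geometric_composition n (p n))
        {C. contains_square_pattern n K C}"
      unfolding r_def using p [of n] K by (intro prob_square_pattern_ge) auto
    finally show ?case by (simp add: K_def)
  qed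
  then show ?thesis
    by (intro tendsto_sandwich [OF _ _ lower tendsto_const]) simp_all
qed

theorem proposition4p5:
  fixes c :: real and \<theta> p q k :: "nat \<Rightarrow> real"
  assumes "\<And>n. \<theta> n > 0"
    and "\<And>n. p n \<in> {0..<1}"
    and "\<And>n. q n = 1 - p n"
    and "\<forall>\<^sub>F n in sequentially. q n = \<theta> n * ln (ln (real n)) / ln (real n)"
    and "\<forall>\<^sub>F n in sequentially.
           k n = ln (real n) / ln (ln (real n)) *
                 (1 + c * ln (ln (ln (real n))) / ln (ln (real n)))"
  shows "(c \<ge> 1 \<or> far \<theta> \<longrightarrow>
           (\<lambda>n. measure_pmf.prob (geometric_composition n (p n))
                  {C. contains_square_pattern n (nat \<lfloor>k n\<rfloor>) C}) \<longlonglongrightarrow> 0) \<and>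
         (c < 1 \<and> near \<theta> \<longrightarrow>
           (\<lambda>n. measure_pmf.prob (geometric_composition n (p n))
                  {C. contains_square_pattern n (nat \<lfloor>k n\<rfloor>) C}) \<longlonglongrightarrow> 1)"
proof -
  have q: "\<forall>\<^sub>F n in sequentially. 1 - p n = \<theta> n * ln (ln (real n)) / ln (real n)"
    using assms(3,4) by simp
  have k: "\<forall>\<^sub>F n in sequentially. k n = critical_length c n"
    using assms(5) unfolding critical_length_def .
  note tendsto_0 = prob_square_pattern_tendsto_0 [OF assms(1,2) q k]
  have "(\<lambda>n. measure_pmf.prob (geometric_composition n (p n))
          {C. contains_square_pattern n (nat \<lfloor>k n\<rfloor>) C}) \<longlonglongrightarrow> 0" if "c \<ge> 1"
  proof (rule tendsto_0 [OF that, where s = "\<lambda>n. ln (ln (ln (real n))) - 1 / 2"])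
    show "\<forall>\<^sub>F n in sequentially. \<forall>a\<ge>3 / 4.
        ln (ln (ln (real n))) + (ln (\<theta> n) - a * \<theta> n) \<le> ln (ln (ln (real n))) - 1 / 2"
      using ln_minus_mult_le [OF assms(1)] by (intro always_eventually allI impI) force
    show "\<forall>\<^sub>F n in sequentially. ln (ln (ln (real n))) - 1 / 2 \<le> ln (ln (real n))"
      by real_asymp
    show "filterlim (\<lambda>n. ln (real n) + (critical_length 1 n - 1) *
        (ln (ln (ln (real n))) - 1 / 2 - ln (ln (real n)))) at_bot sequentially"
      by (rule exponent_at_bot_boundary)
  qed
  moreover have "(\<lambda>n. measure_pmf.prob (geometric_composition n (p n))
          {C. contains_square_pattern n (nat \<lfloor>k n\<rfloor>) C}) \<longlonglongrightarrow> 0" if "far \<theta>"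
  proof (rule tendsto_0 [OF order_refl, where s = "\<lambda>n. (c - 1) * ln (ln (ln (real n)))"])
    \<comment> \<open>any slope below \<open>c\<close> will do; \<open>c - 1\<close> corresponds to \<open>\<gamma> = 2 - c\<close>\<close>
    show "\<forall>\<^sub>F n in sequentially. \<forall>a\<ge>3 / 4.
        ln (ln (ln (real n))) + (ln (\<theta> n) - a * \<theta> n) \<le> (c - 1) * ln (ln (ln (real n)))"
      using far_imp_eventually_le [OF that assms(1), of "2 - c"]
      by eventually_elim (force simp: algebra_simps)
    show "\<forall>\<^sub>F n in sequentially. (c - 1) * ln (ln (ln (real n))) \<le> ln (ln (real n))"
      by real_asymp
    show "filterlim (\<lambda>n. ln (real n) + (critical_length c n - 1) *
        ((c - 1) * ln (ln (ln (real n))) - ln (ln (real n)))) at_bot sequentially"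
      by (rule exponent_at_bot) simp
  qed
  moreover have "(\<lambda>n. measure_pmf.prob (geometric_composition n (p n))
          {C. contains_square_pattern n (nat \<lfloor>k n\<rfloor>) C}) \<longlonglongrightarrow> 1" if "c < 1" "near \<theta>"
    using prob_square_pattern_tendsto_1 [OF assms(1,2) q k that] .
  ultimately show ?thesis by blast
qed

end
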